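(* Let $d\ge 2$. Any $Y\in\mathcal{M}_{\mathbf r}\subset\mathbb{R}^{n_1\times\cdots\times n_d}$ can be exactly represented as a rank-$\mathbf r$ TT-cross interpolant with nested indices. That is, there exist nested multi-index sets $\{\mathcal I^{\le k},\mathcal I^{>k}\}_{k=1}^{d-1}$, with $\mathcal I^{\le k}$ and $\mathcal I^{>k}$ each containing $r_k$ multi-indices, such that the $r_k\times r_k$ matrices $Y(\mathcal I^{\le k},\mathcal I^{>k})$ are invertible for $k=1,\dots,d-1$ and, for all $(i_1,\dots,i_d)$, $$Y(i_1,\dots,i_d)=\left(\prod_{k=1}^{d-1}Y\bigl(\mathcal I^{\le k-1},i_k,\mathcal I^{>k}\bigr)\bigl[Y\bigl(\mathcal I^{\le k},\mathcal I^{>k}\bigr)\bigr]^{-1}\right)Y\bigl(\mathcal I^{\le d-1},i_d\bigr),$$ where the product is ordered from $k=1$ (left) to $k=d-1$ (right).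
   Context: For $Y\in\mathbb{R}^{n_1\times\cdots\times n_d}$, $\mathbf Y^{\langle k\rangle}\in\mathbb{R}^{(n_1\cdots n_k)\times(n_{k+1}\cdots n_d)}$ is the unfolding with rows indexed by $(i_1,\dots,i_k)$ and columns by $(i_{k+1},\dots,i_d)$. The TT-rank of $Y$ is $\mathbf r=(1,r_1,\dots,r_{d-1},1)$ with $r_k=\operatorname{rank}\mathbf Y^{\langle k\rangle}$ (so $r_0=r_d=1$), and $\mathcal{M}_{\mathbf r}=\{Y:\text{TT-rank}(Y)=\mathbf r\}$. $\mathcal I^{\le k}$ denotes a set (ordered list) of multi-indices $(i_1,\dots,i_k)$ and $\mathcal I^{>k}$ one of multi-indices $(i_{k+1},\dots,i_d)$. They are nested if for $k=1,\dots,d-1$ $$\mathcal I^{\le k}\subset\mathcal I^{\le k-1}\times\{1,\dots,n_k\},\qquad \mathcal I^{>k}\subset\{1,\dots,n_{k+1}\}\times\mathcal I^{>k+1},$$ where $\mathcal I^{\le 0}$ and $\mathcal I^{>d}$ are trivial (the corresponding argument is omitted). $Y(\mathcal I^{\le k},\mathcal I^{>k})$ is the $r_k\times r_k$ matrix with rows indexed by $\mathcal I^{\le k}$ and columns by $\mathcal I^{>k}$; for fixed $i_k$, $Y(\mathcal I^{\le k-1},i_k,\mathcal I^{>k})$ is the $r_{k-1}\times r_k$ matrix with rows indexed by $\mathcal I^{\le k-1}$ and columns by $\mathcal I^{>k}$ (a row vector for $k=1$), and $Y(\mathcal I^{\le d-1},i_d)$ is an $r_{d-1}\times 1$ column. 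*)

theory Defs
  imports Jordan_Normal_Form.DL_Rank Jordan_Normal_Form.Gauss_Jordan_Elimination
begin

text \<open>
  A tensor with mode sizes \<open>ns = [n\<^sub>1, \<dots>, n\<^sub>d]\<close> is a real function on multi-indices
  \<open>[i\<^sub>1, \<dots>, i\<^sub>d]\<close>, \<open>1 \<le> i\<^sub>k \<le> n\<^sub>k\<close>. The function is total on lists, but only its values on
  \<open>multi_indices ns\<close> matter. Positions in lists count from 0, so \<open>n\<^sub>k\<close> is \<open>ns ! (k - 1)\<close>
  and \<open>i\<^sub>k\<close> is \<open>i ! (k - 1)\<close>.
\<close>

type_synonym tensor = "nat list \<Rightarrow> real"

text \<open>Listed lexicographically; \<open>multi_indices [] = [[]]\<close>.\<close>

definition multi_indices :: "nat list \<Rightarrow> nat list list" where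
  "multi_indices ns = product_lists (map (\<lambda>n. [1..<Suc n]) ns)"

text \<open>The matrix \<open>Y(I, J)\<close>.\<close>

definition subtensor :: "tensor \<Rightarrow> nat list list \<Rightarrow> nat list list \<Rightarrow> real mat" where
  "subtensor Y I J = mat (length I) (length J) (\<lambda>(a, b). Y (I ! a @ J ! b))"

text \<open>The matrix \<open>Y(I, i, J)\<close> for a fixed middle index \<open>i\<close>.\<close>

definition slice :: "tensor \<Rightarrow> nat list list \<Rightarrow> nat \<Rightarrow> nat list list \<Rightarrow> real mat" where
  "slice Y I i J = mat (length I) (length J) (\<lambda>(a, b). Y (I ! a @ i # J ! b))"

definition unfolding_mat :: "nat list \<Rightarrow> tensor \<Rightarrow> nat \<Rightarrow> real mat" where
  "unfolding_mat ns Y k = subtensor Y (multi_indices (take k ns)) (multi_indices (drop k ns))"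

definition mat_rank :: "real mat \<Rightarrow> nat" where
  "mat_rank A = vec_space.rank (dim_row A) A"

definition tt_rank :: "nat list \<Rightarrow> tensor \<Rightarrow> nat list" where
  "tt_rank ns Y = 1 # map (\<lambda>k. mat_rank (unfolding_mat ns Y k)) [1..<length ns] @ [1]"

definition tt_manifold :: "nat list \<Rightarrow> nat list \<Rightarrow> tensor set" where
  "tt_manifold ns r = {Y. tt_rank ns Y = r}"

text \<open>
  \<open>L k\<close> and \<open>R k\<close> are the ordered lists of left and right multi-indices at the cut between
  modes \<open>k\<close> and \<open>k + 1\<close>. The trivial index sets \<open>L 0\<close> and \<open>R d\<close> consist of the empty
  multi-index alone, so that the corresponding argument of \<open>Y\<close> disappears.
\<close>

definition nested :: "nat list \<Rightarrow> (nat \<Rightarrow> nat list list) \<Rightarrow> (nat \<Rightarrow> nat list list) \<Rightarrow> bool" where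
  "nested ns L R \<longleftrightarrow>
     L 0 = [[]] \<and> R (length ns) = [[]] \<and>
     (\<forall>k\<in>{1..<length ns}.
        set (L k) \<subseteq> {p @ [i] | p i. p \<in> set (L (k - 1)) \<and> i \<in> {1..ns ! (k - 1)}} \<and>
        set (R k) \<subseteq> {i # q | i q. i \<in> {1..ns ! k} \<and> q \<in> set (R (k + 1))})"

text \<open>Only meaningful for invertible \<open>A\<close>, where \<^const>\<open>mat_inverse\<close> does not return \<^const>\<open>None\<close>.\<close>

definition mat_inv :: "real mat \<Rightarrow> real mat" where
  "mat_inv A = the (mat_inverse A)"

text \<open>
  The entry at multi-index \<open>i\<close> of the TT-cross interpolant of an order-\<open>d\<close> tensor. The matrix
  expression is \<open>1 \<times> 1\<close>, since \<open>L 0\<close> and \<open>R d\<close> have length one when they are trivial.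
\<close>

definition tt_cross ::
  "nat \<Rightarrow> tensor \<Rightarrow> (nat \<Rightarrow> nat list list) \<Rightarrow> (nat \<Rightarrow> nat list list) \<Rightarrow> nat list \<Rightarrow> real" where
  "tt_cross d Y L R i =
     (foldl (*) (1\<^sub>m 1)
        (map (\<lambda>k. slice Y (L (k - 1)) (i ! (k - 1)) (R k) * mat_inv (subtensor Y (L k) (R k)))
          [1..<d])
      * slice Y (L (d - 1)) (i ! (d - 1)) (R d)) $$ (0, 0)"

end

theory Submission
  imports Defs
begin

text \<open>
  If the rows with index set \<open>I\<close> span the row space of the unfolding at one cut, then the rows with
  indices in \<open>I \<times> {1, \<dots>, n}\<close> span the row space at the next cut, and a row basis can be
  chosen among them; this gives nested left sets. Reversing the tensor gives nested column bases.
  At each cut the submatrix on a row basis and a column basis is invertible, and every row of the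
  unfolding is a combination of the basis rows, with coefficients recovered from the basis columns:
  \<open>Y(P, R) Y(L, R)\<^sup>-\<^sup>1 Y(L, Q) = Y(P, Q)\<close>. Applied at successive cuts, with \<open>P\<close> the previous
  left set extended by the current index, this telescopes the interpolant to \<open>Y\<close>.
\<close>

section \<open>Generating and independent rows of a real function of two arguments\<close>

text \<open>Rows are treated as functions on the column set \<open>J\<close>, over arbitrary index
  types, so that swapping the arguments of \<open>F\<close> gives the same notion for
  columns.\<close>

definition generates :: "('a \<Rightarrow> 'b \<Rightarrow> real) \<Rightarrow> 'b set \<Rightarrow> 'a set \<Rightarrow> 'a set \<Rightarrow> bool" where
  "generates F J B I \<longleftrightarrow> (\<forall>p\<in>I. \<exists>c. \<forall>q\<in>J. F p q = (\<Sum>b\<in>B. c b * F b q))"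

text \<open>Coefficients belong to indices, not to row vectors: two distinct indices in
  \<open>B\<close> with equal rows already form a dependency.\<close>

definition independent_rows :: "('a \<Rightarrow> 'b \<Rightarrow> real) \<Rightarrow> 'b set \<Rightarrow> 'a set \<Rightarrow> bool" where
  "independent_rows F J B \<longleftrightarrow>
     (\<forall>c. (\<forall>q\<in>J. (\<Sum>b\<in>B. c b * F b q) = 0) \<longrightarrow> (\<forall>b\<in>B. c b = 0))"

lemma generates_self:
  assumes "finite I"
  shows "generates F J I I"
  unfolding generates_def
proof
  fix p assume "p \<in> I"
  then have "\<forall>q\<in>J. F p q = (\<Sum>b\<in>I. (if b = p then 1 else 0) * F b q)"
    using assms by (simp add: if_distrib[of "\<lambda>x. x * _"] cong: if_cong)
  then show "\<exists>c. \<forall>q\<in>J. F p q = (\<Sum>b\<in>I. c b * F b q)"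
    by (rule exI[of _ "\<lambda>b. if b = p then 1 else 0"])
qed

lemma generates_trans:
  assumes BC: "generates F J B C" and CI: "generates F J C I"
  shows "generates F J B I"
  unfolding generates_def
proof
  fix p assume "p \<in> I"
  then obtain c where c: "\<forall>q\<in>J. F p q = (\<Sum>b\<in>C. c b * F b q)"
    using CI unfolding generates_def by blast
  obtain e where e: "\<forall>b\<in>C. \<forall>q\<in>J. F b q = (\<Sum>x\<in>B. e b x * F x q)"
    using BC unfolding generates_def by metis
  have "F p q = (\<Sum>x\<in>B. (\<Sum>b\<in>C. c b * e b x) * F x q)" if q: "q \<in> J" for q
  proof -
    have "F p q = (\<Sum>b\<in>C. c b * (\<Sum>x\<in>B. e b x * F x q))"
      using c e q by simp
    also have "\<dots> = (\<Sum>x\<in>B. (\<Sum>b\<in>C. c b * e b x) * F x q)"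
      unfolding sum_distrib_left sum_distrib_right mult.assoc by (rule sum.swap)
    finally show ?thesis .
  qed
  then show "\<exists>c. \<forall>q\<in>J. F p q = (\<Sum>b\<in>B. c b * F b q)"
    by (intro exI[of _ "\<lambda>x. \<Sum>b\<in>C. c b * e b x"]) blast
qed

text \<open>Greedy selection: a new index joins the basis exactly when its row is not generated by
  the rows already chosen.\<close>

lemma exists_basis:
  assumes "finite I"
  shows "\<exists>B\<subseteq>I. generates F J B I \<and> independent_rows F J B"
  using assms
proof (induction I rule: finite_induct)
  case empty
  show ?case by (simp add: generates_def independent_rows_def)
next
  case (insert x I)
  then obtain B where B: "B \<subseteq> I" "generates F J B I" "independent_rows F J B" by blast
  have fin: "finite B" and xB: "x \<notin> B" using insert.hyps B finite_subset by auto
  show ?case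
  proof (cases "generates F J B {x}")
    case True
    then have "generates F J B (insert x I)" using B(2) by (simp add: generates_def)
    then show ?thesis using B by blast
  next
    case False
    \<comment> \<open>A dependency with nonzero coefficient at \<open>x\<close> could be solved for
      row \<open>x\<close>, which this case excludes.\<close>
    have cx: "c x = 0" if c: "\<forall>q\<in>J. (\<Sum>b\<in>insert x B. c b * F b q) = 0" for c
    proof (rule ccontr)
      assume nz: "c x \<noteq> 0"
      have "F x q = (\<Sum>b\<in>B. (- c b / c x) * F b q)" if q: "q \<in> J" for q
      proof -
        have "c x * F x q = - (\<Sum>b\<in>B. c b * F b q)"
          using c q fin xB by (simp add: eq_neg_iff_add_eq_0)
        then have "F x q = - (\<Sum>b\<in>B. c b * F b q) / c x"
          using nz by (simp add: field_simps)
        also have "\<dots> = (\<Sum>b\<in>B. (- c b / c x) * F b q)"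
          by (simp add: sum_negf sum_divide_distrib)
        finally show ?thesis .
      qed
      then have "generates F J B {x}"
        unfolding generates_def by (auto intro!: exI[of _ "\<lambda>b. - c b / c x"])
      then show False using False by simp
    qed
    have "independent_rows F J (insert x B)"
      unfolding independent_rows_def
    proof (intro allI impI)
      fix c assume c: "\<forall>q\<in>J. (\<Sum>b\<in>insert x B. c b * F b q) = 0"
      then have "\<forall>q\<in>J. (\<Sum>b\<in>B. c b * F b q) = 0"
        using cx[OF c] fin xB by simp
      then have "\<forall>b\<in>B. c b = 0" using B(3) unfolding independent_rows_def by blast
      then show "\<forall>b\<in>insert x B. c b = 0" using cx[OF c] by simp
    qed
    moreover have "generates F J (insert x B) (insert x B)"
      using fin by (intro generates_self) simp
    moreover have "generates F J (insert x B) I"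
    proof (rule generates_trans[OF _ B(2)])
      show "generates F J (insert x B) B"
        using \<open>generates F J (insert x B) (insert x B)\<close> by (simp add: generates_def)
    qed
    ultimately show ?thesis using B(1)
      by (intro exI[of _ "insert x B"]) (auto simp: generates_def)
  qed
qed

section \<open>Sampled matrices\<close>

text \<open>Common form of \<open>subtensor\<close> and \<open>slice\<close>; arbitrary
  \<open>F\<close> also covers the transpose.\<close>

definition sample :: "('a \<Rightarrow> 'b \<Rightarrow> real) \<Rightarrow> 'a list \<Rightarrow> 'b list \<Rightarrow> real mat" where
  "sample F P Q = mat (length P) (length Q) (\<lambda>(a, b). F (P ! a) (Q ! b))"

lemma sample_carrier [simp]: "sample F P Q \<in> carrier_mat (length P) (length Q)"
  by (simp add: sample_def)

lemma sum_set_nth: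
  assumes "distinct xs"
  shows "(\<Sum>x\<in>set xs. f x) = (\<Sum>j = 0..<length xs. f (xs ! j))"
  using sum.reindex_bij_betw[OF bij_betw_nth[OF assms refl refl], of f] by (simp add: atLeast0LessThan)

text \<open>Turns a vector indexed by positions into coefficients indexed by the listed elements;
  distinctness makes this well defined.\<close>

lemma exists_nth_fun:
  assumes "distinct xs"
  shows "\<exists>c. \<forall>a<length xs. c (xs ! a) = f a"
proof -
  have "inj_on ((!) xs) {..<length xs}" using assms by (simp add: inj_on_nth)
  then show ?thesis
    by (intro exI[of _ "\<lambda>x. f (inv_into {..<length xs} ((!) xs) x)"]) simp
qed

text \<open>\<open>D\<close> collects the coefficients of the rows \<open>Ps\<close> in terms of the
  rows \<open>Ls\<close>. It is fixed before \<open>Qs\<close>, so one \<open>D\<close> serves every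
  choice of columns.\<close>

lemma sample_factor:
  assumes "distinct Ls" and "generates F J (set Ls) I" and "set Ps \<subseteq> I"
  obtains D where "D \<in> carrier_mat (length Ps) (length Ls)"
    and "\<And>Qs. set Qs \<subseteq> J \<Longrightarrow> sample F Ps Qs = D * sample F Ls Qs"
proof -
  obtain c where c: "\<forall>p\<in>I. \<forall>q\<in>J. F p q = (\<Sum>b\<in>set Ls. c p b * F b q)"
    using assms(2) unfolding generates_def by metis
  define D where "D = mat (length Ps) (length Ls) (\<lambda>(a, b). c (Ps ! a) (Ls ! b))"
  have "sample F Ps Qs = D * sample F Ls Qs" if "set Qs \<subseteq> J" for Qs
  proof (rule eq_matI)
    fix a b assume "a < dim_row (D * sample F Ls Qs)" "b < dim_col (D * sample F Ls Qs)"
    then have ab: "a < length Ps" "b < length Qs" by (auto simp: D_def sample_def)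
    then have "Ps ! a \<in> I" "Qs ! b \<in> J" using assms(3) that by auto
    then show "sample F Ps Qs $$ (a, b) = (D * sample F Ls Qs) $$ (a, b)"
      using ab c by (simp add: D_def sample_def scalar_prod_def sum_set_nth[OF assms(1)])
  qed (auto simp: D_def sample_def)
  then show thesis using that[of D] by (simp add: D_def)
qed

text \<open>Factoring through the rows \<open>Ls\<close> on the columns \<open>Rs\<close> and
  cancelling with \<open>N\<close> recovers the coefficient matrix \<open>D\<close>; the same
  \<open>D\<close> then reproduces the columns \<open>Qs\<close>.\<close>

lemma sample_cross:
  assumes "distinct Ls" and "generates F J (set Ls) I"
    and "set Ps \<subseteq> I" and "set Rs \<subseteq> J" and "set Qs \<subseteq> J"
    and N: "N \<in> carrier_mat (length Rs) (length Ls)" and inv: "sample F Ls Rs * N = 1\<^sub>m (length Ls)"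
  shows "sample F Ps Rs * N * sample F Ls Qs = sample F Ps Qs"
proof -
  obtain D where D: "D \<in> carrier_mat (length Ps) (length Ls)"
    and fac: "\<And>Qs. set Qs \<subseteq> J \<Longrightarrow> sample F Ps Qs = D * sample F Ls Qs"
    using sample_factor[OF assms(1-3)] by blast
  have "sample F Ps Rs * N = D * (sample F Ls Rs * N)"
    using fac[OF assms(4)] by (simp add: assoc_mult_mat[OF D sample_carrier N])
  then have "sample F Ps Rs * N = D"
    using inv D by simp
  then show ?thesis using fac[OF assms(5)] by simp
qed

text \<open>If there were fewer rows than columns, padding with zero rows would give a square matrix
  with trivial kernel, hence nonzero determinant, although its row \<open>m\<close> is zero.\<close>

lemma trivial_kernel_imp_cols_le_rows:
  fixes M :: "'a :: field mat"
  assumes M: "M \<in> carrier_mat m n"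
    and ker: "\<And>v. v \<in> carrier_vec n \<Longrightarrow> M *\<^sub>v v = 0\<^sub>v m \<Longrightarrow> v = 0\<^sub>v n"
  shows "n \<le> m"
proof (rule ccontr)
  assume "\<not> n \<le> m"
  then have mn: "m < n" by simp
  define P where "P = mat n n (\<lambda>(a, b). if a < m then M $$ (a, b) else 0)"
  have P: "P \<in> carrier_mat n n" by (simp add: P_def)
  have "v = 0\<^sub>v n" if v: "v \<in> carrier_vec n" and Pv: "P *\<^sub>v v = 0\<^sub>v n" for v
  proof (rule ker[OF v], rule eq_vecI)
    fix a assume "a < dim_vec (0\<^sub>v m :: 'a vec)"
    then have a: "a < m" by simp
    have "(M *\<^sub>v v) $ a = (P *\<^sub>v v) $ a"
      using a mn M v by (simp add: P_def scalar_prod_def)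
    then show "(M *\<^sub>v v) $ a = 0\<^sub>v m $ a" using Pv a mn by simp
  qed (use M in simp)
  then have "det P \<noteq> 0"
    using det_0_iff_vec_prod_zero_field[OF P] by blast
  moreover have "P\<^sup>T *\<^sub>v unit_vec n m = 0\<^sub>v n"
    by (rule eq_vecI) (use mn in \<open>auto simp: P_def\<close>)
  then have "det P\<^sup>T = 0"
    using det_0_iff_vec_prod_zero_field[of "P\<^sup>T" n] P mn by (metis transpose_carrier_mat unit_vec_carrier unit_vec_nonzero)
  ultimately show False using det_transpose[OF P] by simp
qed

text \<open>A kernel vector is a dependency among the columns \<open>Rs\<close> seen on the rows
  \<open>Ls\<close>. Those rows generate all rows in \<open>I\<close>, so the dependency holds on
  all of \<open>I\<close>, and independence makes it trivial.\<close>

lemma sample_mult_vec_eq_0: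
  assumes Rs: "distinct Rs" "independent_rows (\<lambda>q p. F p q) I (set Rs)"
    and Ls: "distinct Ls" "generates F J (set Ls) I" and RJ: "set Rs \<subseteq> J"
    and v: "v \<in> carrier_vec (length Rs)" and ker: "sample F Ls Rs *\<^sub>v v = 0\<^sub>v (length Ls)"
  shows "v = 0\<^sub>v (length Rs)"
proof -
  obtain c where c: "\<forall>a<length Rs. c (Rs ! a) = v $ a"
    using exists_nth_fun[OF Rs(1)] by blast
  have L0: "(\<Sum>q\<in>set Rs. c q * F b q) = 0" if b: "b \<in> set Ls" for b
  proof -
    obtain a where a: "a < length Ls" "b = Ls ! a" using b by (metis in_set_conv_nth)
    have "(\<Sum>q\<in>set Rs. c q * F b q) = (sample F Ls Rs *\<^sub>v v) $ a"
      using a v c by (simp add: sum_set_nth[OF Rs(1)] sample_def scalar_prod_def mult.commute)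
    then show ?thesis using ker a by simp
  qed
  have "(\<Sum>q\<in>set Rs. c q * F p q) = 0" if p: "p \<in> I" for p
  proof -
    obtain e where e: "\<forall>q\<in>J. F p q = (\<Sum>b\<in>set Ls. e b * F b q)"
      using Ls(2) p unfolding generates_def by blast
    have "(\<Sum>q\<in>set Rs. c q * F p q) = (\<Sum>q\<in>set Rs. \<Sum>b\<in>set Ls. c q * (e b * F b q))"
      using e RJ by (intro sum.cong) (auto simp: sum_distrib_left)
    also have "\<dots> = (\<Sum>b\<in>set Ls. e b * (\<Sum>q\<in>set Rs. c q * F b q))"
      unfolding sum_distrib_left by (subst sum.swap) (simp add: mult.left_commute)
    finally show ?thesis using L0 by simp
  qed
  then have "\<forall>q\<in>set Rs. c q = 0" using Rs(2) unfolding independent_rows_def by blast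
  then show ?thesis using c v by (intro eq_vecI) auto
qed

text \<open>The kernel argument applies to the matrix and to its transpose. This bounds each length
  by the other, and a square matrix with trivial kernel has nonzero determinant.\<close>

lemma row_col_bases:
  assumes Ls: "distinct Ls" "set Ls \<subseteq> I" "generates F J (set Ls) I" "independent_rows F J (set Ls)"
    and Rs: "distinct Rs" "set Rs \<subseteq> J" "generates (\<lambda>q p. F p q) I (set Rs) J"
      "independent_rows (\<lambda>q p. F p q) I (set Rs)"
  shows "length Ls = length Rs" and "det (sample F Ls Rs) \<noteq> 0"
proof -
  have ker: "v = 0\<^sub>v (length Rs)"
    if "v \<in> carrier_vec (length Rs)" "sample F Ls Rs *\<^sub>v v = 0\<^sub>v (length Ls)" for v
    using sample_mult_vec_eq_0[OF Rs(1,4) Ls(1,3) Rs(2)] that by blast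
  have ker': "v = 0\<^sub>v (length Ls)"
    if "v \<in> carrier_vec (length Ls)" "sample (\<lambda>q p. F p q) Rs Ls *\<^sub>v v = 0\<^sub>v (length Rs)" for v
    using sample_mult_vec_eq_0[of Ls "\<lambda>q p. F p q", OF Ls(1,4) Rs(1,3) Ls(2)] that by blast
  show len: "length Ls = length Rs"
    using trivial_kernel_imp_cols_le_rows[OF sample_carrier[of F Ls Rs] ker]
      trivial_kernel_imp_cols_le_rows[OF sample_carrier[of "\<lambda>q p. F p q" Rs Ls] ker']
    by (simp add: le_antisym)
  have "sample F Ls Rs \<in> carrier_mat (length Rs) (length Rs)"
    by (metis len sample_carrier)
  then show "det (sample F Ls Rs) \<noteq> 0"
    using det_0_iff_vec_prod_zero_field[of "sample F Ls Rs" "length Rs"] ker len by metis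
qed

text \<open>The columns indexed by \<open>C\<close> are pairwise distinct, independent and spanning,
  hence a basis of the column space. This links the size of a column basis to the TT-rank.\<close>

lemma rank_sample:
  assumes CJ: "C \<subseteq> set Q" and gen: "generates (\<lambda>q p. F p q) (set P) C (set Q)"
    and ind: "independent_rows (\<lambda>q p. F p q) (set P) C"
  shows "vec_space.rank (length P) (sample F P Q) = card C"
proof -
  interpret vec_space "TYPE(real)" "length P" .
  define col where "col q = vec (length P) (\<lambda>a. F (P ! a) q)" for q
  have fin: "finite C" using CJ finite_subset by auto
  have cols: "set (cols (sample F P Q)) = col ` set Q"
    by (force simp: cols_def sample_def col_def set_conv_nth image_iff intro!: eq_vecI)
  have carr: "col ` S \<subseteq> carrier_vec (length P)" for S by (auto simp: col_def)
  have inj: "inj_on col C"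
  proof (rule inj_onI, rule ccontr)
    fix x y assume xy: "x \<in> C" "y \<in> C" "col x = col y" "x \<noteq> y"
    \<comment> \<open>The difference of the indicators of \<open>x\<close> and \<open>y\<close>:
      equal columns at distinct indices would make it a nontrivial dependency.\<close>
    define c where "c b = (if b = x then 1 else 0) - (if b = y then 1 else (0::real))" for b
    have "(\<Sum>b\<in>C. c b * F p b) = 0" if "p \<in> set P" for p
    proof -
      obtain a where a: "a < length P" "p = P ! a" using \<open>p \<in> set P\<close> by (metis in_set_conv_nth)
      have "(\<Sum>b\<in>C. c b * F p b) = F p x - F p y"
        using xy fin by (simp add: c_def left_diff_distrib sum_subtractf
          if_distrib[of "\<lambda>z. z * _"] cong: if_cong)
      also have "\<dots> = col x $ a - col y $ a" using a by (simp add: col_def)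
      finally show ?thesis using xy by simp
    qed
    then have "c x = 0" using ind xy unfolding independent_rows_def by blast
    then show False using xy by (simp add: c_def)
  qed
  have lincomb: "lincomb e (col ` C) $ a = (\<Sum>b\<in>C. e (col b) * F (P ! a) b)" if "a < length P" for e a
    using that by (simp add: lincomb_index carr sum.reindex[OF inj]) (simp add: col_def)
  have lincomb_dim: "dim_vec (lincomb e (col ` C)) = length P" for e
    using lincomb_dim[OF _ carr] fin by simp
  have "lin_indpt (col ` C)"
  proof (rule finite_lin_indpt2)
    fix e assume zero: "lincomb e (col ` C) = 0\<^sub>v (length P)"
    have "(\<Sum>b\<in>C. e (col b) * F p b) = 0" if "p \<in> set P" for p
      using that lincomb[of _ e] zero by (metis in_set_conv_nth index_zero_vec(1))
    then have "\<forall>b\<in>C. e (col b) = 0" 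
      using spec[OF ind[unfolded independent_rows_def], of "\<lambda>b. e (col b)"] by blast
    then show "\<forall>v\<in>col ` C. e v = 0" by simp
  qed (use fin carr in auto)
  \<comment> \<open>The dimension of a span is read off from a maximal independent subset, which
    here is the whole set.\<close>
  then have "maximal (col ` C) (\<lambda>T. T \<subseteq> col ` C \<and> lin_indpt T)"
    by (auto simp: maximal_def)
  then have dim: "vectorspace.dim class_ring (span_vs (col ` C)) = card (col ` C)"
    using dim_span[of "col ` C"] carr fin by simp
  have "col ` set Q \<subseteq> span (col ` C)"
  proof
    fix v assume "v \<in> col ` set Q"
    then obtain q where q: "q \<in> set Q" "v = col q" by blast
    then obtain c where c: "\<forall>p\<in>set P. F p q = (\<Sum>b\<in>C. c b * F p b)"
      using gen unfolding generates_def by blast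
    \<comment> \<open>\<open>lincomb\<close> takes coefficients indexed by vectors, so
      \<open>c\<close> is transported along the inverse of the injective map
      \<open>col\<close>.\<close>
    define e where "e w = c (the_inv_into C col w)" for w
    have "v = lincomb e (col ` C)"
    proof (rule eq_vecI)
      show "dim_vec v = dim_vec (lincomb e (col ` C))"
        unfolding lincomb_dim by (simp add: q col_def)
      fix a assume "a < dim_vec (lincomb e (col ` C))"
      then have a: "a < length P" by (simp add: lincomb_dim)
      then have "v $ a = (\<Sum>b\<in>C. c b * F (P ! a) b)" using q c by (simp add: col_def)
      also have "\<dots> = (\<Sum>b\<in>C. e (col b) * F (P ! a) b)"
        by (rule sum.cong) (auto simp: e_def the_inv_into_f_f[OF inj])
      finally show "v $ a = lincomb e (col ` C) $ a" using lincomb[OF a] by simp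
    qed
    then show "v \<in> span (col ` C)" using fin by blast
  qed
  then have "span (col ` set Q) = span (col ` C)"
    using span_subsetI[OF carr] span_is_monotone[of "col ` C" "col ` set Q"] CJ
    by (simp add: image_mono subset_antisym)
  then show ?thesis
    unfolding rank_def cols using dim card_image[OF inj] by simp
qed

section \<open>Nested bases of the unfoldings\<close>

lemma set_multi_indices: "set (multi_indices ns) = {i. list_all2 (\<lambda>i n. i \<in> {1..n}) i ns}"
  by (auto simp: multi_indices_def product_lists_set list_all2_map2 elim!: list_all2_mono)

lemma set_multi_indices_Nil [simp]: "set (multi_indices []) = {[]}"
  by (simp add: multi_indices_def)

lemma set_multi_indices_Cons:
  "set (multi_indices (n # ns)) = {i # q | i q. i \<in> {1..n} \<and> q \<in> set (multi_indices ns)}"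
  by (auto simp: set_multi_indices list_all2_Cons2)

lemma set_multi_indices_snoc:
  "set (multi_indices (ns @ [n])) = {p @ [i] | p i. p \<in> set (multi_indices ns) \<and> i \<in> {1..n}}"
proof (rule Set.set_eqI)
  fix x
  show "x \<in> set (multi_indices (ns @ [n])) \<longleftrightarrow>
    x \<in> {p @ [i] | p i. p \<in> set (multi_indices ns) \<and> i \<in> {1..n}}"
  proof (cases x rule: rev_cases)
    case Nil
    then show ?thesis by (simp add: set_multi_indices)
  next
    case (snoc p i)
    have "list_all2 P (p @ [i]) (ns @ [n]) \<longleftrightarrow> list_all2 P p ns \<and> P i n" for P
      using list_all2_rev[of P "p @ [i]" "ns @ [n]"] list_all2_rev[of P p ns] by auto
    then show ?thesis by (simp add: set_multi_indices snoc)
  qed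
qed

lemma set_multi_indices_rev: "set (multi_indices (rev ns)) = rev ` set (multi_indices ns)"
proof -
  have "i \<in> set (multi_indices (rev ns)) \<longleftrightarrow> rev i \<in> set (multi_indices ns)" for i
    using list_all2_rev[of "\<lambda>i n. i \<in> {1..n}" "rev i" ns] by (simp add: set_multi_indices)
  then show ?thesis by (force intro: rev_image_eqI)
qed

lemma drop_multi_indices:
  "i \<in> set (multi_indices ns) \<Longrightarrow> drop k i \<in> set (multi_indices (drop k ns))"
  by (simp add: set_multi_indices)

text \<open>Row \<open>p @ [i]\<close> at column \<open>q\<close> is row \<open>p\<close> at column
  \<open>i # q\<close>. A relation between rows at one cut, restricted to columns starting with
  \<open>i\<close>, is therefore a relation between rows ending in \<open>i\<close> at the next
  cut.\<close>

lemma generates_snoc: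
  assumes fin: "finite B" "finite A"
    and gen: "generates (\<lambda>p q. Y (p @ q)) {i # q | i q. i \<in> A \<and> q \<in> J} B I"
  shows "generates (\<lambda>p q. Y (p @ q)) J {p @ [i] | p i. p \<in> B \<and> i \<in> A} {p @ [i] | p i. p \<in> I \<and> i \<in> A}"
    (is "generates ?F J ?X _")
  unfolding generates_def
proof
  fix x assume "x \<in> {p @ [i] | p i. p \<in> I \<and> i \<in> A}"
  then obtain p i where x: "x = p @ [i]" "p \<in> I" "i \<in> A" by blast
  obtain c where c: "\<forall>q\<in>{i # q | i q. i \<in> A \<and> q \<in> J}. ?F p q = (\<Sum>b\<in>B. c b * ?F b q)"
    using gen x(2) unfolding generates_def by blast
  \<comment> \<open>The old coefficients are placed on the rows ending in \<open>i\<close>; all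
    other rows get 0.\<close>
  define e where "e y = (if last y = i then c (butlast y) else 0)" for y
  have "?X = (\<lambda>(p, i). p @ [i]) ` (B \<times> A)" by auto
  then have finX: "finite ?X" using fin by simp
  have "?F x q = (\<Sum>y\<in>?X. e y * ?F y q)" if q: "q \<in> J" for q
  proof -
    have "?F x q = (\<Sum>b\<in>B. c b * Y (b @ i # q))"
      using c x q by auto
    also have "\<dots> = (\<Sum>y\<in>(\<lambda>b. b @ [i]) ` B. e y * ?F y q)"
      by (subst sum.reindex) (auto simp: inj_on_def e_def)
    also have "\<dots> = (\<Sum>y\<in>?X. e y * ?F y q)"
      by (rule sum.mono_neutral_left[OF finX]) (use x in \<open>auto simp: e_def\<close>)
    finally show ?thesis .
  qed
  then show "\<exists>e. \<forall>q\<in>J. ?F x q = (\<Sum>y\<in>?X. e y * ?F y q)" by blast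
qed

text \<open>The bases are chosen recursively: the extensions of \<open>B k\<close> by one index
  generate the rows at the next cut, and \<open>B (Suc k)\<close> is a basis selected among them.
  Independence is claimed only after cut 0, since the single row \<open>[]\<close> is dependent when
  the tensor vanishes.\<close>

lemma nested_row_bases:
  fixes Y :: tensor
  obtains B where "B 0 = {[]}"
    and "\<And>k. k < length ns \<Longrightarrow> B (Suc k) \<subseteq> {p @ [i] | p i. p \<in> B k \<and> i \<in> {1..ns ! k}}"
    and "\<And>k. k < length ns \<Longrightarrow>
      independent_rows (\<lambda>p q. Y (p @ q)) (set (multi_indices (drop (Suc k) ns))) (B (Suc k))"
    and "\<And>k. k \<le> length ns \<Longrightarrow> B k \<subseteq> set (multi_indices (take k ns))"
    and "\<And>k. k \<le> length ns \<Longrightarrow> generates (\<lambda>p q. Y (p @ q)) (set (multi_indices (drop k ns))) (B k)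
      (set (multi_indices (take k ns)))"
proof -
  let ?F = "\<lambda>p q. Y (p @ q)"
  let ?I = "\<lambda>k. set (multi_indices (take k ns))" and ?J = "\<lambda>k. set (multi_indices (drop k ns))"
  \<comment> \<open>\<open>P\<close> is the invariant at one cut and \<open>S\<close> the relation
    between consecutive cuts. Both are guarded by bounds on \<open>k\<close>, because dependent
    choice produces a sequence over all natural numbers.\<close>
  define P where "P k B \<longleftrightarrow> (k = 0 \<longrightarrow> B = {[]}) \<and>
    (k \<le> length ns \<longrightarrow> B \<subseteq> ?I k \<and> generates ?F (?J k) B (?I k))" for k B
  define S where "S k B B' \<longleftrightarrow> (k < length ns \<longrightarrow>
    B' \<subseteq> {p @ [i] | p i. p \<in> B \<and> i \<in> {1..ns ! k}} \<and> independent_rows ?F (?J (Suc k)) B')" for k B B'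
  have "\<exists>B. \<forall>k. P k (B k) \<and> S k (B k) (B (Suc k))"
  proof (rule dependent_nat_choice)
    show "\<exists>B. P 0 B"
      by (intro exI[of _ "{[]}"]) (simp add: P_def generates_self)
    fix B k assume PB: "P k B"
    show "\<exists>B'. P (Suc k) B' \<and> S k B B'"
    proof (cases "k < length ns")
      case False
      then show ?thesis by (simp add: P_def S_def)
    next
      case True
      let ?X = "{p @ [i] | p i. p \<in> B \<and> i \<in> {1..ns ! k}}"
      have B: "B \<subseteq> ?I k" "generates ?F (?J k) B (?I k)" using PB True by (auto simp: P_def)
      have I: "?I (Suc k) = {p @ [i] | p i. p \<in> ?I k \<and> i \<in> {1..ns ! k}}"
        using True by (simp add: take_Suc_conv_app_nth set_multi_indices_snoc)
      have J: "?J k = {i # q | i q. i \<in> {1..ns ! k} \<and> q \<in> ?J (Suc k)}"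
        using True by (simp flip: Cons_nth_drop_Suc add: set_multi_indices_Cons)
      have X: "?X \<subseteq> ?I (Suc k)" using B(1) unfolding I by blast
      have finB: "finite B" using finite_subset[OF B(1)] by simp
      have gen: "generates ?F (?J (Suc k)) ?X (?I (Suc k))"
        unfolding I by (rule generates_snoc) (use finB B(2) J in simp_all)
      have "finite ?X" using finite_subset[OF X] by simp
      then obtain B' where B': "B' \<subseteq> ?X" "generates ?F (?J (Suc k)) B' ?X"
          "independent_rows ?F (?J (Suc k)) B'"
        using exists_basis by blast
      then show ?thesis
        using generates_trans[OF B'(2) gen] X unfolding P_def S_def by (intro exI[of _ B']) blast
    qed
  qed
  then obtain B where "P k (B k)" "S k (B k) (B (Suc k))" for k by blast
  then show thesis unfolding P_def S_def by (intro that[of B]) simp_all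
qed

text \<open>Coefficients move along the inverse of \<open>g\<close>, while \<open>h\<close> renames
  the columns at which the relation is tested. With reversal for both maps, this carries bases of
  the reversed tensor back to the original one.\<close>

lemma generates_image:
  assumes "inj_on g B" and gen: "generates (\<lambda>p q. F (g p) (h q)) J B I"
  shows "generates F (h ` J) (g ` B) (g ` I)"
  unfolding generates_def
proof
  fix x assume "x \<in> g ` I"
  then obtain p where p: "p \<in> I" "x = g p" by blast
  then obtain c where c: "\<forall>q\<in>J. F (g p) (h q) = (\<Sum>b\<in>B. c b * F (g b) (h q))"
    using gen unfolding generates_def by blast
  have "F x q = (\<Sum>b\<in>g ` B. c (the_inv_into B g b) * F b q)" if "q \<in> h ` J" for q
    using that c p assms(1) by (auto simp: sum.reindex the_inv_into_f_f intro!: sum.cong)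
  then show "\<exists>c. \<forall>q\<in>h ` J. F x q = (\<Sum>b\<in>g ` B. c b * F b q)"
    by (intro exI[of _ "\<lambda>b. c (the_inv_into B g b)"]) blast
qed

lemma independent_rows_image:
  assumes "inj_on g B" and ind: "independent_rows (\<lambda>p q. F (g p) (h q)) J B"
  shows "independent_rows F (h ` J) (g ` B)"
  unfolding independent_rows_def
proof (intro allI impI)
  fix c assume "\<forall>q\<in>h ` J. (\<Sum>b\<in>g ` B. c b * F b q) = 0"
  then have "\<forall>q\<in>J. (\<Sum>b\<in>B. c (g b) * F (g b) (h q)) = 0"
    using assms(1) by (simp add: sum.reindex)
  then have "\<forall>b\<in>B. c (g b) = 0"
    using spec[OF ind[unfolded independent_rows_def], of "\<lambda>b. c (g b)"] by blast
  then show "\<forall>b\<in>g ` B. c b = 0" by blast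
qed

text \<open>Reversing all multi-indices exchanges the roles of rows and columns.\<close>

lemma nested_col_bases:
  fixes Y :: tensor
  obtains C where "C (length ns) = {[]}"
    and "\<And>k. k < length ns \<Longrightarrow> C k \<subseteq> {i # q | i q. i \<in> {1..ns ! k} \<and> q \<in> C (Suc k)}"
    and "\<And>k. k < length ns \<Longrightarrow>
      independent_rows (\<lambda>q p. Y (p @ q)) (set (multi_indices (take k ns))) (C k)"
    and "\<And>k. k \<le> length ns \<Longrightarrow> C k \<subseteq> set (multi_indices (drop k ns))"
    and "\<And>k. k \<le> length ns \<Longrightarrow> generates (\<lambda>q p. Y (p @ q)) (set (multi_indices (take k ns))) (C k)
      (set (multi_indices (drop k ns)))"
proof -
  let ?I = "\<lambda>k. set (multi_indices (take k ns))" and ?J = "\<lambda>k. set (multi_indices (drop k ns))"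
  \<comment> \<open>The unfolding of the reversed tensor: reversing \<open>p @ q\<close> gives
    \<open>rev q @ rev p\<close>, so its rows come from right multi-indices of
    \<open>Y\<close>.\<close>
  let ?G = "\<lambda>p q. Y (rev q @ rev p)"
  obtain B where B0: "B 0 = {[]}"
    and Bs: "\<And>k. k < length ns \<Longrightarrow> B (Suc k) \<subseteq> {p @ [i] | p i. p \<in> B k \<and> i \<in> {1..rev ns ! k}}"
    and ind: "\<And>k. k < length ns \<Longrightarrow>
      independent_rows ?G (set (multi_indices (drop (Suc k) (rev ns)))) (B (Suc k))"
    and sub: "\<And>k. k \<le> length ns \<Longrightarrow> B k \<subseteq> set (multi_indices (take k (rev ns)))"
    and gen: "\<And>k. k \<le> length ns \<Longrightarrow> generates ?G (set (multi_indices (drop k (rev ns)))) (B k)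
         (set (multi_indices (take k (rev ns))))"
    by (fact nested_row_bases[of "rev ns" "\<lambda>i. Y (rev i)", unfolded rev_append length_rev])
  define C where "C k = rev ` B (length ns - k)" for k
  have take: "rev ` set (multi_indices (take (length ns - k) (rev ns))) = ?J k"
    and drop: "rev ` set (multi_indices (drop (length ns - k) (rev ns))) = ?I k"
    if "k \<le> length ns" for k
    using that by (simp_all add: take_rev drop_rev set_multi_indices_rev image_image)
  show thesis
  proof
    show "C (length ns) = {[]}" by (simp add: C_def B0)
  next
    fix k assume k: "k \<le> length ns"
    show "C k \<subseteq> ?J k"
      unfolding C_def take[OF k, symmetric] by (intro image_mono sub) simp
    show "generates (\<lambda>q p. Y (p @ q)) (?I k) (C k) (?J k)"
      unfolding C_def take[OF k, symmetric] drop[OF k, symmetric]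
      by (rule generates_image[where F = "\<lambda>q p. Y (p @ q)" and g = rev and h = rev, OF inj_on_rev gen]) simp
  next
    fix k assume k: "k < length ns"
    \<comment> \<open>Reversal sends cut \<open>k\<close> to cut \<open>length ns - k\<close>, so
      going from cut \<open>Suc k\<close> down to \<open>k\<close> is going from \<open>m\<close> up
      to \<open>Suc m\<close> in the reversed tensor.\<close>
    define m where "m = length ns - Suc k"
    have m: "length ns - k = Suc m" "m < length ns" "rev ns ! m = ns ! k"
      using k by (auto simp: m_def rev_nth)
    show "C k \<subseteq> {i # q | i q. i \<in> {1..ns ! k} \<and> q \<in> C (Suc k)}"
    proof
      fix x assume "x \<in> C k"
      then obtain p i where "x = rev (p @ [i])" "p \<in> B m" "i \<in> {1..ns ! k}"
        using Bs[OF m(2)] unfolding C_def m by blast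
      then show "x \<in> {i # q | i q. i \<in> {1..ns ! k} \<and> q \<in> C (Suc k)}"
        by (auto simp: C_def m_def)
    qed
    show "independent_rows (\<lambda>q p. Y (p @ q)) (?I k) (C k)"
      unfolding C_def drop[OF less_imp_le[OF k], symmetric] m(1)
      by (rule independent_rows_image[where F = "\<lambda>q p. Y (p @ q)" and g = rev and h = rev,
            OF inj_on_rev ind[OF m(2)]])
  qed
qed

section \<open>The interpolant\<close>

lemma subtensor_eq_sample: "subtensor Y P Q = sample (\<lambda>p q. Y (p @ q)) P Q"
  by (simp add: subtensor_def sample_def)

text \<open>Absorbing the fixed index into the rows turns a slice into a submatrix of the unfolding
  at the next cut, the form to which the cross identity applies.\<close>

lemma slice_eq_sample: "slice Y P i Q = sample (\<lambda>p q. Y (p @ q)) (map (\<lambda>p. p @ [i]) P) Q"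
  by (intro eq_matI) (auto simp: slice_def sample_def)

text \<open>A nonzero determinant rules out \<open>None\<close> as the value of
  \<open>mat_inverse\<close>, so \<open>mat_inv\<close> is the true inverse.\<close>

lemma det_nonzero_mat_inv:
  assumes M: "M \<in> carrier_mat n n" and det: "det M \<noteq> 0"
  shows "mat_inv M \<in> carrier_mat n n" and "M * mat_inv M = 1\<^sub>m n" and "invertible_mat M"
proof -
  obtain N where "mat_inverse M = Some N"
    using mat_inverse(1)[OF M, of "()"] det_non_zero_imp_unit[OF M det, of "()"] by fastforce
  then have N: "M * N = 1\<^sub>m n" "N * M = 1\<^sub>m n" "N \<in> carrier_mat n n" "mat_inv M = N"
    using mat_inverse(2)[OF M] by (auto simp: mat_inv_def)
  then show "mat_inv M \<in> carrier_mat n n" "M * mat_inv M = 1\<^sub>m n" by auto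
  show "invertible_mat M"
    using N M unfolding invertible_mat_def inverts_mat_def square_mat.simps by auto
qed

lemma tt_cross_exact:
  fixes Y :: tensor
  assumes d: "1 \<le> d" "length ns = d" and i: "i \<in> set (multi_indices ns)"
    and L0: "L 0 = [[]]" and Rd: "R d = [[]]"
    and L: "\<And>k. k \<in> {1..<d} \<Longrightarrow> distinct (L k) \<and>
      generates (\<lambda>p q. Y (p @ q)) (set (multi_indices (drop k ns))) (set (L k)) (set (multi_indices (take k ns)))"
    and Lsub: "\<And>k. k < d \<Longrightarrow> set (L k) \<subseteq> set (multi_indices (take k ns))"
    and Rsub: "\<And>k. k \<in> {1..<d} \<Longrightarrow> set (R k) \<subseteq> set (multi_indices (drop k ns))"
    and len: "\<And>k. k \<in> {1..<d} \<Longrightarrow> length (L k) = length (R k)"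
    and det: "\<And>k. k \<in> {1..<d} \<Longrightarrow> det (subtensor Y (L k) (R k)) \<noteq> 0"
  shows "tt_cross d Y L R i = Y i"
proof -
  let ?F = "\<lambda>p q. Y (p @ q)"
  define T where
    "T = (\<lambda>k. slice Y (L (k - 1)) (i ! (k - 1)) (R k) * mat_inv (subtensor Y (L k) (R k)))"
  define Pr where "Pr k = foldl (*) (1\<^sub>m 1) (map T [1..<Suc k])" for k
  have leni: "length i = d" using i d by (auto simp: set_multi_indices dest: list_all2_lengthD)
  have step: "slice Y (L k) (i ! k) Q = sample ?F (map (\<lambda>p. p @ [i ! k]) (L k)) Q" for k Q
    by (rule slice_eq_sample)
  \<comment> \<open>The same tensor entries, with the first remaining index moved from the column to
    the rows.\<close>
  have shift: "sample ?F (map (\<lambda>p. p @ [i ! k]) (L k)) [drop (Suc k) i] = sample ?F (L k) [drop k i]"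
    if "k < d" for k
    using that leni by (intro eq_matI) (auto simp: sample_def Cons_nth_drop_Suc)
  \<comment> \<open>Telescoping invariant: the first \<open>k\<close> factors times the column of
    \<open>Y\<close> on \<open>L k\<close> and the remaining indices of \<open>i\<close> already
    give \<open>Y i\<close>.\<close>
  have main: "Pr k \<in> carrier_mat 1 (length (L k)) \<and> Pr k * sample ?F (L k) [drop k i] = sample ?F [[]] [i]"
    if "k < d" for k
    using that
  proof (induction k)
    case 0
    show ?case
      using left_mult_one_mat[OF sample_carrier[of ?F "[[]]" "[i]"]] by (simp add: Pr_def L0)
  next
    case (Suc k)
    let ?k = "Suc k" and ?Ps = "map (\<lambda>p. p @ [i ! k]) (L k)"
    have k: "?k \<in> {1..<d}" using Suc.prems by simp
    define N where "N = mat_inv (subtensor Y (L ?k) (R ?k))"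
    have M: "subtensor Y (L ?k) (R ?k) \<in> carrier_mat (length (L ?k)) (length (L ?k))"
      using sample_carrier[of ?F "L ?k" "R ?k"] len[OF k] by (simp add: subtensor_eq_sample)
    have N: "N \<in> carrier_mat (length (L ?k)) (length (L ?k))"
      "sample ?F (L ?k) (R ?k) * N = 1\<^sub>m (length (L ?k))"
      unfolding N_def using det_nonzero_mat_inv[OF M det[OF k]] by (simp_all add: subtensor_eq_sample)
    have "i ! k \<in> {1..ns ! k}"
      using i Suc.prems leni d by (auto simp: set_multi_indices list_all2_conv_all_nth)
    then have Ps: "set ?Ps \<subseteq> set (multi_indices (take ?k ns))"
      using Lsub[of k] Suc.prems d by (auto simp: take_Suc_conv_app_nth set_multi_indices_snoc)
    \<comment> \<open>The cross identity at cut \<open>Suc k\<close>, with the previous left set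
      extended by the current index as rows and the remaining indices as the only column.\<close>
    have cross: "sample ?F ?Ps (R ?k) * N * sample ?F (L ?k) [drop ?k i] = sample ?F ?Ps [drop ?k i]"
      using L[OF k] Ps Rsub[OF k] N drop_multi_indices[OF i, of ?k]
      by (intro sample_cross[where I = "set (multi_indices (take ?k ns))"
            and J = "set (multi_indices (drop ?k ns))"]) (simp_all add: len[OF k])
    have T: "T ?k = sample ?F ?Ps (R ?k) * N" by (simp add: T_def N_def step)
    have Tc: "T ?k \<in> carrier_mat (length (L k)) (length (L ?k))"
      unfolding T using N(1) len[OF k] sample_carrier[of ?F ?Ps "R ?k"] by (simp add: mult_carrier_mat)
    have Pk: "Pr k \<in> carrier_mat 1 (length (L k))"
      and IH: "Pr k * sample ?F (L k) [drop k i] = sample ?F [[]] [i]"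
      using Suc by auto
    have Pr: "Pr ?k = Pr k * T ?k" by (simp add: Pr_def)
    have "Pr ?k * sample ?F (L ?k) [drop ?k i] = Pr k * (T ?k * sample ?F (L ?k) [drop ?k i])"
      unfolding Pr by (rule assoc_mult_mat[OF Pk Tc sample_carrier])
    also have "\<dots> = sample ?F [[]] [i]"
      unfolding T cross using shift[of k] Suc.prems IH by simp
    finally show ?case using Pk Tc by (simp add: Pr mult_carrier_mat)
  qed
  obtain e where e: "d = Suc e" using d by (cases d) auto
  have "tt_cross d Y L R i = (Pr e * slice Y (L e) (i ! e) (R d)) $$ (0, 0)"
    by (simp add: tt_cross_def T_def Pr_def e)
  \<comment> \<open>The last slice has no indices left on its right, so it is the column in the
    invariant at cut \<open>d - 1\<close>.\<close>
  also have "slice Y (L e) (i ! e) (R d) = sample ?F (L e) [drop e i]"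
    using shift[of e] leni Rd unfolding step e by simp
  also have "(Pr e * sample ?F (L e) [drop e i]) $$ (0, 0) = Y i"
    using main[of e] by (simp add: e sample_def)
  finally show ?thesis .
qed

section \<open>Enumerating the bases and assembling the interpolant\<close>

lemma exists_enumerations:
  assumes "\<And>k. k \<in> K \<Longrightarrow> finite (B k)"
  shows "\<exists>L. \<forall>k\<in>K. set (L k) = B k \<and> distinct (L k)"
  by (rule bchoice) (use assms finite_distinct_list in blast)

lemma distinct_set_singleton:
  assumes "distinct xs" and "set xs = {x}"
  shows "xs = [x]"
  using assms by (cases xs) (auto simp: subset_singleton_iff)

theorem corollary5p1:
  fixes d :: nat and ns r :: "nat list" and Y :: tensor
  assumes "d \<ge> 2" and "length ns = d"
    and "Y \<in> tt_manifold ns r"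
  shows "\<exists>L R. nested ns L R \<and>
    (\<forall>k\<in>{1..<d}.
       distinct (L k) \<and> length (L k) = r ! k \<and>
       distinct (R k) \<and> length (R k) = r ! k \<and>
       invertible_mat (subtensor Y (L k) (R k))) \<and>
    (\<forall>i\<in>set (multi_indices ns). Y i = tt_cross d Y L R i)"
proof -
  let ?I = "\<lambda>k. set (multi_indices (take k ns))" and ?J = "\<lambda>k. set (multi_indices (drop k ns))"
  let ?F = "\<lambda>p q. Y (p @ q)" and ?G = "\<lambda>q p. Y (p @ q)"
  obtain B where B0: "B 0 = {[]}"
    and Bs: "\<And>k. k < d \<Longrightarrow> B (Suc k) \<subseteq> {p @ [i] | p i. p \<in> B k \<and> i \<in> {1..ns ! k}}"
    and Bind: "\<And>k. k < d \<Longrightarrow> independent_rows ?F (?J (Suc k)) (B (Suc k))"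
    and Bsub: "\<And>k. k \<le> d \<Longrightarrow> B k \<subseteq> ?I k"
    and Bgen: "\<And>k. k \<le> d \<Longrightarrow> generates ?F (?J k) (B k) (?I k)"
    by (fact nested_row_bases[of ns Y, unfolded assms(2)])
  obtain C where Cd: "C d = {[]}"
    and Cs: "\<And>k. k < d \<Longrightarrow> C k \<subseteq> {i # q | i q. i \<in> {1..ns ! k} \<and> q \<in> C (Suc k)}"
    and Cind: "\<And>k. k < d \<Longrightarrow> independent_rows ?G (?I k) (C k)"
    and Csub: "\<And>k. k \<le> d \<Longrightarrow> C k \<subseteq> ?J k"
    and Cgen: "\<And>k. k \<le> d \<Longrightarrow> generates ?G (?I k) (C k) (?J k)"
    by (fact nested_col_bases[of ns Y, unfolded assms(2)])
  obtain L where L: "\<And>k. k \<le> d \<Longrightarrow> set (L k) = B k" "\<And>k. k \<le> d \<Longrightarrow> distinct (L k)"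
    using exists_enumerations[of "{..d}" B] finite_subset[OF Bsub] by auto
  obtain R where R: "\<And>k. k \<le> d \<Longrightarrow> set (R k) = C k" "\<And>k. k \<le> d \<Longrightarrow> distinct (R k)"
    using exists_enumerations[of "{..d}" C] finite_subset[OF Csub] by auto
  have L0: "L 0 = [[]]" and Rd: "R d = [[]]"
    using distinct_set_singleton L[of 0] R[of d] B0 Cd by auto
  have nested: "nested ns L R"
    unfolding nested_def
  proof (intro conjI ballI)
    fix k assume "k \<in> {1..<length ns}"
    then have k: "Suc (k - 1) = k" "k - 1 < d" "k < d" "k \<le> d" "k - 1 \<le> d" "Suc k \<le> d"
      using assms(2) by auto
    show "set (L k) \<subseteq> {p @ [i] | p i. p \<in> set (L (k - 1)) \<and> i \<in> {1..ns ! (k - 1)}}"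
      using Bs[of "k - 1"] k L by simp
    show "set (R k) \<subseteq> {i # q | i q. i \<in> {1..ns ! k} \<and> q \<in> set (R (k + 1))}"
      using Cs[of k] k R by simp
  qed (use L0 Rd assms(2) in auto)
  have pivot: "length (L k) = length (R k)" "det (subtensor Y (L k) (R k)) \<noteq> 0" if "k \<in> {1..<d}" for k
  proof -
    have k: "Suc (k - 1) = k" "k - 1 < d" "k < d" "k \<le> d" using that by auto
    \<comment> \<open>Row independence is available from cut 1 on, so it is taken from the step
      leaving cut \<open>k - 1\<close>.\<close>
    have "independent_rows ?F (?J k) (B k)" using Bind[OF k(2)] k(1) by simp
    then show "length (L k) = length (R k)" "det (subtensor Y (L k) (R k)) \<noteq> 0"
      unfolding subtensor_eq_sample
      using row_col_bases[of "L k" "?I k" ?F "?J k" "R k"] k L R Bsub Bgen Csub Cgen Cind by auto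
  qed
  have rank: "length (R k) = r ! k" if "k \<in> {1..<d}" for k
  proof -
    have k: "k < d" "k \<le> d" using that by auto
    \<comment> \<open>The leading 1 in \<open>tt_rank\<close> shifts the list so that the rank at
      cut \<open>k\<close> sits at position \<open>k\<close>.\<close>
    have "r ! k = mat_rank (unfolding_mat ns Y k)"
      using assms that by (auto simp: tt_manifold_def tt_rank_def nth_Cons' nth_append)
    also have "\<dots> = card (C k)"
      using rank_sample[of "C k" "multi_indices (drop k ns)" ?F "multi_indices (take k ns)"]
        Csub Cgen Cind k
      by (simp add: mat_rank_def unfolding_mat_def subtensor_eq_sample sample_def)
    also have "\<dots> = length (R k)" using R[OF k(2)] distinct_card by metis
    finally show ?thesis by simp
  qed
  have "invertible_mat (subtensor Y (L k) (R k))" if k: "k \<in> {1..<d}" for k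
  proof (rule det_nonzero_mat_inv(3))
    show "subtensor Y (L k) (R k) \<in> carrier_mat (length (L k)) (length (L k))"
      using sample_carrier[of ?F "L k" "R k"] pivot(1)[OF k] by (simp add: subtensor_eq_sample)
  qed (rule pivot(2)[OF k])
  moreover have "Y i = tt_cross d Y L R i" if "i \<in> set (multi_indices ns)" for i
  proof (rule tt_cross_exact[symmetric])
    fix k
    show "set (L k) \<subseteq> ?I k" if "k < d" using Bsub[of k] L(1)[of k] that by simp
    show "set (R k) \<subseteq> ?J k" if "k \<in> {1..<d}" using Csub[of k] R(1)[of k] that by simp
    show "distinct (L k) \<and> generates ?F (?J k) (set (L k)) (?I k)" if "k \<in> {1..<d}"
      using Bgen[of k] L[of k] that by simp
  qed (use assms that L0 Rd pivot in simp_all)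
  ultimately show ?thesis
    using nested rank pivot(1) L(2) R(2) by (intro exI[of _ L] exI[of _ R]) auto
qed

end
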